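(* Let $A,\Pi\subset\mathbb{R}\setminus\{0\}$ be finite sets with $|\Pi|\geq|A|$, and let $T\geq 1$ be such that $r_{\Pi/\Pi}(a)\geq T$ for all $a\in A$. Then \[ |A+A|^{19}\,|\Pi|^{44}\geq |A|^{41-o(1)}\,T^{33}\,. \]
   Context: For finite sets $X,Y\subseteq\mathbb{R}\setminus\{0\}$ and $x\in\mathbb{R}$, $r_{X/Y}(x)=|\{(u,v)\in X\times Y: x=u/v\}|$ is the number of representations of $x$ as a ratio. $A+A=\{a+b:a,b\in A\}$. The term $o(1)$ denotes a quantity tending to $0$ as $|A|\to\infty$, uniformly in $\Pi$ and $T$. *)

theory Defs
  imports Complex_Main "HOL-Library.Set_Algebras"
begin

definition ratio_reps :: "real set \<Rightarrow> real set \<Rightarrow> real \<Rightarrow> nat" where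
  "ratio_reps X Y x = card {(u, v) \<in> X \<times> Y. x = u / v}"

end

theory Submission
  imports Defs "HOL-Real_Asymp.Real_Asymp"
begin

text \<open>
  Put \<open>n = |A|\<close>, \<open>s = |A + A|\<close> and \<open>K = |\<Pi>|\<^sup>4 / T\<^sup>3\<close>. Writing \<open>a = p / q\<close>, a solution of
  \<open>x = a - b\<close> becomes an incidence between the point \<open>(x, 1 / q)\<close> and the line \<open>x + b = p u\<close>.
  The points form a Cartesian product, so the Szemeredi--Trotter bound follows from
  cutting the grid into \<open>r \<times> r\<close> cells, of which a line meets at most \<open>2 r\<close>. Hence at most
  \<open>O(K |B|\<^sup>2 / t\<^sup>3)\<close> differences \<open>x\<close> have \<open>t\<close> representations in \<open>A - B\<close>, and the third moment of
  the number of representations is \<open>O(K |B|\<^sup>2 log n)\<close>.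

  Let \<open>P\<close> be the \<open>m\<close> differences with at least \<open>t\<close> representations, inside a large subset \<open>A'\<close> of
  \<open>A\<close> any two elements of which share many partners forming popular sums. Counting triples with
  \<open>(a + b) - (b + c) = a - c \<in> P\<close> and both sums popular by Cauchy--Schwarz, the third moment and
  Hoelder gives \<open>m\<^sup>7 t\<^sup>1\<^sup>2 n\<^sup>9 \<lless> s\<^sup>1\<^sup>0 K\<^sup>9\<close> up to logarithms. Together with \<open>m t\<^sup>3 \<lless> K n\<^sup>2\<close> and the
  energy bound \<open>n\<^sup>4 / s \<lless> max\<^sub>t m t\<^sup>2\<close> this yields \<open>n\<^sup>4\<^sup>1 \<lless> s\<^sup>1\<^sup>9 K\<^sup>1\<^sup>1\<close>.
\<close>

section \<open>Counting collisions\<close>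

lemma card_eq_sum_card_fibers:
  assumes "finite X" "finite Y" "f ` X \<subseteq> Y"
  shows "card X = (\<Sum>y\<in>Y. card {x\<in>X. f x = y})"
  using sum.group[OF assms, of "\<lambda>_. 1::nat"] by simp

text \<open>Keep one representative of each fibre; every other element forms a collision with its
  representative. Only off-diagonal pairs are charged, so that incidences can later be charged to
  pairs of distinct points.\<close>

lemma card_le_card_image_add_collisions:
  assumes "finite X"
  shows "card X \<le> card (f ` X) + card {(x, y) \<in> X \<times> X. x \<noteq> y \<and> f x = f y}"
proof -
  define g where "g = inv_into X f"
  define Y where "Y = g ` f ` X"
  have g: "g (f x) \<in> X" "f (g (f x)) = f x" if "x \<in> X" for x
    using that by (auto simp: g_def inv_into_into f_inv_into_f)
  have "card (X - Y) \<le> card {(x, y) \<in> X \<times> X. x \<noteq> y \<and> f x = f y}"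
  proof (rule card_inj_on_le)
    show "inj_on (\<lambda>x. (x, g (f x))) (X - Y)" by (auto simp: inj_on_def)
    show "(\<lambda>x. (x, g (f x))) ` (X - Y) \<subseteq> {(x, y) \<in> X \<times> X. x \<noteq> y \<and> f x = f y}"
      using g by (auto simp: Y_def)
    show "finite {(x, y) \<in> X \<times> X. x \<noteq> y \<and> f x = f y}"
      by (rule finite_subset[of _ "X \<times> X"]) (use assms in auto)
  qed
  moreover have "card Y \<le> card (f ` X)"
    unfolding Y_def by (rule card_image_le) (use assms in auto)
  moreover have "card X \<le> card Y + card (X - Y)"
    using card_Un_le[of Y "X - Y"] card_mono[of "Y \<union> (X - Y)" X] assms
    by (simp add: Y_def)
  ultimately show ?thesis by linarith
qed

text \<open>Asking for \<open>f^2 = g h\<close> pointwise avoids square roots in the weighted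
  applications. The square is expanded over pairs and each product is bounded by AM-GM.\<close>

lemma Cauchy_Schwarz_sum:
  fixes f g h :: "'a \<Rightarrow> real"
  assumes "\<And>x. x \<in> X \<Longrightarrow> g x \<ge> 0" "\<And>x. x \<in> X \<Longrightarrow> h x \<ge> 0"
    and "\<And>x. x \<in> X \<Longrightarrow> (f x)\<^sup>2 = g x * h x"
  shows "(\<Sum>x\<in>X. f x)\<^sup>2 \<le> (\<Sum>x\<in>X. g x) * (\<Sum>x\<in>X. h x)"
proof -
  have le: "f x * f y \<le> (g x * h y + g y * h x) / 2" if "x \<in> X" "y \<in> X" for x y
  proof (rule power2_le_imp_le)
    have "(f x * f y)\<^sup>2 = (g x * h y) * (g y * h x)"
      using assms(3) that by (simp add: power_mult_distrib mult_ac)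
    also have "\<dots> \<le> ((g x * h y + g y * h x) / 2)\<^sup>2"
      using zero_le_power2[of "g x * h y - g y * h x"] by (simp add: power2_eq_square field_simps)
    finally show "(f x * f y)\<^sup>2 \<le> ((g x * h y + g y * h x) / 2)\<^sup>2" .
  qed (use assms that in auto)
  have "(\<Sum>x\<in>X. f x)\<^sup>2 = (\<Sum>x\<in>X. \<Sum>y\<in>X. f x * f y)"
    by (simp add: power2_eq_square sum_product)
  also have "\<dots> \<le> (\<Sum>x\<in>X. \<Sum>y\<in>X. (g x * h y + g y * h x) / 2)"
    by (intro sum_mono le)
  also have "\<dots> = ((\<Sum>x\<in>X. \<Sum>y\<in>X. g x * h y) + (\<Sum>x\<in>X. \<Sum>y\<in>X. g y * h x)) / 2"
    by (simp add: sum.distrib flip: sum_divide_distrib)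
  also have "(\<Sum>x\<in>X. \<Sum>y\<in>X. g y * h x) = (\<Sum>x\<in>X. \<Sum>y\<in>X. g x * h y)"
    by (rule sum.swap)
  finally show ?thesis by (simp add: sum_product)
qed

text \<open>With the diagonal included, the number of collisions is exactly the sum of the squared
  fibre sizes, to which Cauchy-Schwarz applies.\<close>

lemma card_image_collisions_Cauchy_Schwarz:
  assumes "finite X"
  shows "card X ^ 2 \<le> card (f ` X) * card {(x, y) \<in> X \<times> X. f x = f y}"
proof -
  define k where "k y = card {x\<in>X. f x = y}" for y
  have fin: "finite {(x, y) \<in> X \<times> X. f x = f y}"
    by (rule finite_subset[of _ "X \<times> X"]) (use assms in auto)
  have "card {(x, y) \<in> X \<times> X. f x = f y}
      = (\<Sum>z\<in>f ` X. card {q \<in> {(x, y) \<in> X \<times> X. f x = f y}. f (fst q) = z})"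
    by (rule card_eq_sum_card_fibers) (use assms fin in auto)
  also have "\<dots> = (\<Sum>z\<in>f ` X. k z ^ 2)"
  proof (rule sum.cong[OF refl])
    fix z
    have "{q \<in> {(x, y) \<in> X \<times> X. f x = f y}. f (fst q) = z} = {x\<in>X. f x = z} \<times> {x\<in>X. f x = z}"
      by auto
    then show "card {q \<in> {(x, y) \<in> X \<times> X. f x = f y}. f (fst q) = z} = k z ^ 2"
      by (simp add: k_def card_cartesian_product power2_eq_square)
  qed
  finally have coll: "card {(x, y) \<in> X \<times> X. f x = f y} = (\<Sum>z\<in>f ` X. k z ^ 2)" .
  have "card X = (\<Sum>z\<in>f ` X. k z)"
    unfolding k_def by (rule card_eq_sum_card_fibers) (use assms in auto)
  then have "real (card X) ^ 2 = (\<Sum>z\<in>f ` X. real (k z)) ^ 2" by simp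
  also have "\<dots> \<le> (\<Sum>z\<in>f ` X. 1) * (\<Sum>z\<in>f ` X. real (k z) ^ 2)"
    by (rule Cauchy_Schwarz_sum) auto
  also have "\<dots> = real (card (f ` X) * card {(x, y) \<in> X \<times> X. f x = f y})"
    unfolding of_nat_mult coll by simp
  finally show ?thesis by (simp only: of_nat_power[symmetric] of_nat_le_iff)
qed


section \<open>Incidences between lines and Cartesian products\<close>

text \<open>The rank of a point of \<open>D\<close>, rescaled to \<open>0..r - 1\<close>. The
  classes are runs of consecutive elements of nearly equal cardinality, whatever the spacing of
  \<open>D\<close>.\<close>

definition block :: "nat \<Rightarrow> real set \<Rightarrow> real \<Rightarrow> nat" where
  "block r D x = card {y\<in>D. y < x} * r div card D"

lemma block_less:
  assumes "finite D" "x \<in> D"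
  shows "r > 0 \<Longrightarrow> block r D x < r"
proof -
  assume "r > 0"
  have "card {y\<in>D. y < x} < card D"
    by (rule psubset_card_mono) (use assms in auto)
  then show ?thesis
    unfolding block_def using \<open>r > 0\<close> by (intro less_mult_imp_div_less) (simp add: mult.commute)
qed

lemma block_mono:
  assumes "finite D" "x \<le> y"
  shows "block r D x \<le> block r D y"
  unfolding block_def
  by (intro div_le_mono mult_le_mono1 card_mono) (use assms in auto)

text \<open>Ranks are distinct integers, and those of one block differ by less than
  \<open>card D / r\<close>. Rounding costs at most a factor 2 because
  \<open>r \<le> card D\<close>.\<close>

lemma card_block_le:
  assumes "finite D" "r > 0" "r \<le> card D"
  shows "card {x\<in>D. block r D x = k} * r \<le> 2 * card D"
proof (cases "{x\<in>D. block r D x = k} = {}")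
  case False
  define N where "N = card D"
  define i where "i x = card {y\<in>D. y < x}" for x
  define J where "J = i ` {x\<in>D. block r D x = k}"
  have N: "N > 0" using assms by (simp add: N_def)
  have mono: "i x < i y" if "x \<in> D" "x < y" for x y
    unfolding i_def by (rule psubset_card_mono) (use that assms in auto)
  have "inj_on i D"
    by (rule inj_onI) (metis mono less_irrefl linorder_less_linear)
  then have cJ: "card J = card {x\<in>D. block r D x = k}"
    unfolding J_def by (intro card_image) (auto simp: inj_on_def)
  have "finite J" "J \<noteq> {}" using False assms by (auto simp: J_def)
  define m where "m = Min J"
  have "m \<in> J" using \<open>finite J\<close> \<open>J \<noteq> {}\<close> by (simp add: m_def)
  have J: "k * N \<le> j * r \<and> j * r < k * N + N" if "j \<in> J" for j
  proof -
    have "j * r div N = k" using that by (auto simp: J_def i_def block_def N_def)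
    then show ?thesis
      using div_mult_mod_eq[of "j * r" N] mod_less_divisor[OF N, of "j * r"] by simp
  qed
  have "J \<subseteq> {m..m + (N - 1) div r}"
  proof
    fix j assume j: "j \<in> J"
    have "m \<le> j" using j \<open>finite J\<close> by (simp add: m_def)
    have "(j - m) * r < N"
      using J[OF j] J[OF \<open>m \<in> J\<close>] N unfolding diff_mult_distrib by linarith
    then have "j - m \<le> (N - 1) div r"
      using assms(2) by (simp add: less_eq_div_iff_mult_less_eq)
    then show "j \<in> {m..m + (N - 1) div r}" using \<open>m \<le> j\<close> by auto
  qed
  then have "card J \<le> (N - 1) div r + 1"
    using card_mono[of "{m..m + (N - 1) div r}" J] by simp
  then have "card J * r \<le> ((N - 1) div r + 1) * r" by (rule mult_le_mono1)
  also have "\<dots> \<le> 2 * N"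
    using div_times_less_eq_dividend[of "N - 1" r] assms(3)
    unfolding N_def add_mult_distrib by linarith
  finally show ?thesis by (simp add: cJ N_def)
next
  case True
  then show ?thesis by (simp only: True) simp
qed

text \<open>Along a line both block indices are monotone, so their sum or difference determines the cell.\<close>

lemma card_cells_on_line_le:
  fixes p b :: real
  assumes "finite D" "finite U" "r > 0"
  shows "card ((\<lambda>(x, u). (block r D x, block r U u)) ` {(x, u) \<in> D \<times> U. x + b = p * u}) \<le> 2 * r"
    (is "card (?c ` ?L) \<le> _")
proof -
  have lt: "block r D x < r" if "x \<in> D" for x using block_less assms that by blast
  have lt': "block r U x < r" if "x \<in> U" for x using block_less assms that by blast
  have "\<exists>h :: nat \<times> nat \<Rightarrow> nat. inj_on h (?c ` ?L) \<and> h ` (?c ` ?L) \<subseteq> {..<2 * r}"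
  proof (cases "p \<ge> 0")
    case True
    have "inj_on (\<lambda>(i, j). i + j) (?c ` ?L)"
    proof (rule inj_onI, clarsimp, goal_cases)
      case (1 x u y v)
      have "u \<le> v \<and> x \<le> y \<or> v \<le> u \<and> y \<le> x"
        using mult_left_mono[OF _ True, of u v] mult_left_mono[OF _ True, of v u] 1 by linarith
      then show ?case
        using block_mono[OF assms(1), of x y r] block_mono[OF assms(1), of y x r]
          block_mono[OF assms(2), of u v r] block_mono[OF assms(2), of v u r] 1 by linarith
    qed
    moreover have "(\<lambda>(i, j). i + j) ` (?c ` ?L) \<subseteq> {..<2 * r}"
      using lt lt' by (fastforce simp: mult_2 intro: add_strict_mono)
    ultimately show ?thesis by blast
  next
    case False
    \<comment> \<open>The difference \<open>i - j\<close> is shifted by \<open>r\<close> to stay in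
      the naturals; \<open>j < r\<close> keeps the truncated subtraction exact.\<close>
    have "inj_on (\<lambda>(i, j). i + (r - j)) (?c ` ?L)"
    proof (rule inj_onI, clarsimp, goal_cases)
      case (1 x u y v)
      have "u \<le> v \<and> y \<le> x \<or> v \<le> u \<and> x \<le> y"
        using mult_left_mono_neg[of u v p] mult_left_mono_neg[of v u p] 1 False by linarith
      then show ?case
        using block_mono[OF assms(1), of x y r] block_mono[OF assms(1), of y x r]
          block_mono[OF assms(2), of u v r] block_mono[OF assms(2), of v u r] 1 lt'[of u] lt'[of v]
        by linarith
    qed
    moreover have "(\<lambda>(i, j). i + (r - j)) ` (?c ` ?L) \<subseteq> {..<2 * r}"
      using lt by (fastforce simp: mult_2 intro: add_less_le_mono)
    ultimately show ?thesis by blast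
  qed
  then obtain h :: "nat \<times> nat \<Rightarrow> nat"
    where h: "inj_on h (?c ` ?L)" "h ` (?c ` ?L) \<subseteq> {..<2 * r}" by blast
  then show ?thesis using card_inj_on_le[OF h(1) h(2)] by simp
qed

text \<open>A line with more points than the cells it meets has pairs of points in a common cell.
  Two points determine the line, so over all lines these pairs are at most the pairs of grid points
  sharing a cell, and each cell has at most \<open>(2 |D| / r) (2 |U| / r)\<close> points.\<close>

lemma grid_incidence_bound:
  fixes D U P B :: "real set"
  assumes fin: "finite D" "finite U" "finite P" "finite B"
    and r: "r > 0" "r \<le> card D" "r \<le> card U"
  shows "real (\<Sum>(p, b)\<in>P \<times> B. card {(x, u) \<in> D \<times> U. x + b = p * u})
    \<le> 2 * r * card P * card B + 4 * (card D)\<^sup>2 * (card U)\<^sup>2 / r\<^sup>2"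
proof -
  define c where "c = (\<lambda>(x, u). (block r D x, block r U u))"
  define L where "L = (\<lambda>(p, b). {(x, u) \<in> D \<times> U. x + b = p * u})"
  define pairs where "pairs l = {(z, w) \<in> L l \<times> L l. z \<noteq> w \<and> c z = c w}" for l
  define W where "W = {(z, w) \<in> (D \<times> U) \<times> (D \<times> U). c z = c w}"
  have finL: "finite (L l)" for l
    by (rule finite_subset[of _ "D \<times> U"]) (use fin in \<open>auto simp: L_def\<close>)
  have finW: "finite W"
    by (rule finite_subset[of _ "(D \<times> U) \<times> (D \<times> U)"]) (use fin in \<open>auto simp: W_def\<close>)
  have finp: "finite (pairs l)" for l
    by (rule finite_subset[of _ "L l \<times> L l"]) (use finL in \<open>auto simp: pairs_def\<close>)
  have line: "card (L l) \<le> 2 * r + card (pairs l)" for l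
  proof -
    have "card (c ` L l) \<le> 2 * r"
      unfolding c_def L_def using card_cells_on_line_le[OF fin(1,2) r(1)] by (cases l) simp
    then show ?thesis
      using card_le_card_image_add_collisions[OF finL[of l], of c] by (simp add: pairs_def)
  qed
  have "(\<Sum>l\<in>P \<times> B. card (pairs l)) = card (SIGMA l:P \<times> B. pairs l)"
    using fin finp by simp
  also have "\<dots> \<le> card W"
  \<comment> \<open>On a line \<open>u\<close> determines \<open>x\<close>, so distinct points have
    distinct \<open>u\<close>; this fixes the slope \<open>p\<close> and then \<open>b\<close>, and
    the line can be forgotten.\<close>
  proof (rule card_inj_on_le[of snd])
    show "inj_on snd (SIGMA l:P \<times> B. pairs l)"
    proof (rule inj_onI, clarsimp simp: pairs_def L_def, goal_cases)
      case (1 p b x u x' u' p' b')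
      have "(p - p') * (u - u') = 0" using 1 by (simp add: algebra_simps)
      moreover have "u \<noteq> u'" using 1 by auto
      ultimately show ?case using 1 by simp
    qed
    show "snd ` (SIGMA l:P \<times> B. pairs l) \<subseteq> W" by (auto simp: pairs_def L_def W_def)
  qed (rule finW)
  finally have 1: "(\<Sum>l\<in>P \<times> B. card (pairs l)) \<le> card W" .
  have "card W = (\<Sum>z\<in>D \<times> U. card {w\<in>W. fst w = z})"
    by (rule card_eq_sum_card_fibers) (use fin finW in \<open>auto simp: W_def\<close>)
  then have "card W * r\<^sup>2 = (\<Sum>z\<in>D \<times> U. card {w\<in>W. fst w = z} * r\<^sup>2)"
    by (simp add: sum_distrib_right)
  also have "\<dots> \<le> (\<Sum>z\<in>D \<times> U. (2 * card D) * (2 * card U))"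
  proof (rule sum_mono)
    fix z assume z: "z \<in> D \<times> U"
    define X where "X = {x\<in>D. block r D x = fst (c z)}"
    define Y where "Y = {x\<in>U. block r U x = snd (c z)}"
    have "card {w\<in>W. fst w = z} \<le> card (X \<times> Y)"
    proof (rule card_inj_on_le[of snd])
      show "inj_on snd {w\<in>W. fst w = z}" by (auto simp: inj_on_def)
      show "snd ` {w\<in>W. fst w = z} \<subseteq> X \<times> Y" by (auto simp: W_def X_def Y_def c_def)
    qed (use fin in \<open>auto simp: X_def Y_def\<close>)
    then have "card {w\<in>W. fst w = z} * r\<^sup>2 \<le> (card X * r) * (card Y * r)"
      by (simp add: card_cartesian_product power2_eq_square mult_ac)
    also have "\<dots> \<le> (2 * card D) * (2 * card U)"
      unfolding X_def Y_def by (intro mult_le_mono card_block_le fin r)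
    finally show "card {w\<in>W. fst w = z} * r\<^sup>2 \<le> (2 * card D) * (2 * card U)" .
  qed
  also have "\<dots> = 4 * (card D)\<^sup>2 * (card U)\<^sup>2"
    by (simp add: card_cartesian_product power2_eq_square)
  finally have "real (card W * r\<^sup>2) \<le> real (4 * (card D)\<^sup>2 * (card U)\<^sup>2)"
    by (rule of_nat_mono)
  then have 2: "real (card W) \<le> 4 * (card D)\<^sup>2 * (card U)\<^sup>2 / r\<^sup>2"
    using r(1) by (simp add: field_simps)
  have "(\<Sum>l\<in>P \<times> B. card (L l)) \<le> (\<Sum>l\<in>P \<times> B. 2 * r + card (pairs l))"
    by (rule sum_mono) (rule line)
  also have "\<dots> \<le> 2 * r * card P * card B + card W"
    using 1 by (simp add: sum.distrib card_cartesian_product mult_ac)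
  finally have "real (\<Sum>l\<in>P \<times> B. card (L l)) \<le> real (2 * r * card P * card B + card W)"
    by (rule of_nat_mono)
  moreover have "(\<Sum>(p, b)\<in>P \<times> B. card {(x, u) \<in> D \<times> U. x + b = p * u}) = (\<Sum>l\<in>P \<times> B. card (L l))"
    by (rule sum.cong) (auto simp: L_def)
  ultimately show ?thesis using 2 by simp
qed


section \<open>Popular differences\<close>

definition diff_reps :: "real set \<Rightarrow> real set \<Rightarrow> real \<Rightarrow> nat" where
  "diff_reps A B x = card {a\<in>A. a - x \<in> B}"

lemma diff_reps_le_card_left: "finite A \<Longrightarrow> diff_reps A B x \<le> card A"
  unfolding diff_reps_def by (rule card_mono) auto

lemma diff_reps_le_card_right: "finite B \<Longrightarrow> diff_reps A B x \<le> card B"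
  unfolding diff_reps_def by (rule card_inj_on_le[of "\<lambda>a. a - x"]) (auto simp: inj_on_def)

lemma finite_popular_differences:
  assumes "finite A" "finite B" "t > 0"
  shows "finite {x. diff_reps A B x \<ge> t}"
proof (rule finite_subset)
  show "{x. diff_reps A B x \<ge> t} \<subseteq> (\<lambda>(a, b). a - b) ` (A \<times> B)"
  proof
    fix x assume "x \<in> {x. diff_reps A B x \<ge> t}"
    then have "card {a\<in>A. a - x \<in> B} > 0" using assms(3) by (simp add: diff_reps_def)
    then obtain a where "a \<in> A" "a - x \<in> B" by (auto simp: card_gt_0_iff)
    then show "x \<in> (\<lambda>(a, b). a - b) ` (A \<times> B)" by (intro image_eqI[of _ _ "(a, a - x)"]) auto
  qed
qed (use assms in auto)

lemma sum_diff_reps_le: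
  assumes "finite A" "finite B" "finite X"
  shows "(\<Sum>x\<in>X. diff_reps A B x) \<le> card A * card B"
proof -
  have "(\<Sum>x\<in>X. diff_reps A B x) = card (SIGMA x:X. {a\<in>A. a - x \<in> B})"
    unfolding diff_reps_def using assms by simp
  also have "\<dots> \<le> card (A \<times> B)"
    by (rule card_inj_on_le[of "\<lambda>(x, a). (a, a - x)"]) (use assms in \<open>auto simp: inj_on_def\<close>)
  finally show ?thesis by (simp add: card_cartesian_product)
qed

section \<open>From ratio representations to incidences\<close>

lemma ratio_reps_le_card:
  assumes "finite Y" "0 \<notin> Y"
  shows "ratio_reps X Y x \<le> card Y"
  unfolding ratio_reps_def
proof (rule card_inj_on_le)
  show "inj_on snd {(u, v) \<in> X \<times> Y. x = u / v}"
    using assms(2) by (auto simp: inj_on_def field_simps)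
qed (use assms in auto)

text \<open>If a difference \<open>x = a - b\<close> has \<open>a = p / q\<close>, then the point \<open>(x, 1 / q)\<close> lies on the line
  indexed by \<open>(p, b)\<close>.\<close>

lemma popular_differences_incidences:
  fixes A B P D :: "real set" and T :: real
  assumes fin: "finite A" "finite B" "finite P" "finite D" and P: "0 \<notin> P"
    and reps: "\<And>a. a \<in> A \<Longrightarrow> real (ratio_reps P P a) \<ge> T" and T: "T \<ge> 0"
    and D: "\<And>x. x \<in> D \<Longrightarrow> diff_reps A B x \<ge> t"
  shows "card D * t * T
    \<le> real (\<Sum>(p, b)\<in>P \<times> B. card {(x, u) \<in> D \<times> inverse ` P. x + b = p * u})"
proof -
  define R where "R a = {(u, v) \<in> P \<times> P. a = u / v}" for a
  define Z where "Z = (SIGMA l:P \<times> B. {(x, u) \<in> D \<times> inverse ` P. x + snd l = fst l * u})"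
  have finR: "finite (R a)" for a
    by (rule finite_subset[of _ "P \<times> P"]) (use fin in \<open>auto simp: R_def\<close>)
  have finline: "finite {(x, u) \<in> D \<times> inverse ` P. x + b = p * u}" for p b
    by (rule finite_subset[of _ "D \<times> inverse ` P"]) (use fin in auto)
  have finZ: "finite Z" unfolding Z_def using finline fin by (intro finite_SigmaI) auto
  have "card D * t * T = (\<Sum>x\<in>D. t * T)" by simp
  also have "\<dots> \<le> (\<Sum>x\<in>D. \<Sum>a | a \<in> A \<and> a - x \<in> B. real (card (R a)))"
  proof (rule sum_mono)
    fix x assume x: "x \<in> D"
    have "t * T \<le> diff_reps A B x * T" using D[OF x] T by (intro mult_right_mono) auto
    also have "\<dots> = (\<Sum>a | a \<in> A \<and> a - x \<in> B. T)" by (simp add: diff_reps_def)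
    also have "\<dots> \<le> (\<Sum>a | a \<in> A \<and> a - x \<in> B. real (card (R a)))"
      by (rule sum_mono) (use reps in \<open>auto simp: R_def ratio_reps_def\<close>)
    finally show "t * T \<le> (\<Sum>a | a \<in> A \<and> a - x \<in> B. real (card (R a)))" .
  qed
  also have "\<dots> = real (card (SIGMA x:D. SIGMA a:{a\<in>A. a - x \<in> B}. R a))"
    using fin finR by (simp add: finite_SigmaI)
  also have "card (SIGMA x:D. SIGMA a:{a\<in>A. a - x \<in> B}. R a) \<le> card Z"
  \<comment> \<open>Nothing is lost: \<open>x\<close> and \<open>a - x\<close> give back
    \<open>a\<close>, and \<open>inverse q\<close> gives back \<open>q\<close>. The incidence
    equation reads \<open>x + (a - x) = p / q\<close>.\<close>
  proof (rule card_inj_on_le[of "\<lambda>(x, a, p, q). ((p, a - x), (x, inverse q))"])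
    show "inj_on (\<lambda>(x, a, p, q). ((p, a - x), (x, inverse q)))
        (SIGMA x:D. SIGMA a:{a\<in>A. a - x \<in> B}. R a)"
      by (auto simp: inj_on_def)
    show "(\<lambda>(x, a, p, q). ((p, a - x), (x, inverse q))) `
        (SIGMA x:D. SIGMA a:{a\<in>A. a - x \<in> B}. R a) \<subseteq> Z"
      by (auto simp: Z_def R_def divide_inverse)
  qed (rule finZ)
  also have "card Z = (\<Sum>(p, b)\<in>P \<times> B. card {(x, u) \<in> D \<times> inverse ` P. x + b = p * u})"
    unfolding Z_def using fin finline by (subst card_SigmaI) (auto intro!: sum.cong)
  finally show ?thesis by simp
qed

text \<open>Each popular difference gives at least \<open>t T\<close> incidences. Comparing this
  with the grid bound, for a cutting parameter \<open>r\<close> that balances its two terms, gives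
  decay of order \<open>t^(-3)\<close>.\<close>

lemma card_popular_differences_le:
  fixes A B P :: "real set" and T :: real
  assumes fin: "finite A" "finite B" "finite P" and P: "0 \<notin> P" "card A \<le> card P"
    and reps: "\<And>a. a \<in> A \<Longrightarrow> real (ratio_reps P P a) \<ge> T" and T: "T \<ge> 1" and t: "t > 0"
  shows "real (card {x. diff_reps A B x \<ge> t}) * t ^ 3 \<le> 512 * card P ^ 4 / T ^ 3 * (card B)\<^sup>2"
proof (cases "{x. diff_reps A B x \<ge> t} = {}")
  case True
  then show ?thesis using T by (simp only: True) simp
next
  case False
  define D where "D = {x. diff_reps A B x \<ge> t}"
  have finD: "finite D" unfolding D_def by (rule finite_popular_differences[OF fin(1,2) t])
  obtain x where x: "diff_reps A B x \<ge> t" using False by auto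
  define d \<pi> \<beta> where "d = real (card D)" and "\<pi> = real (card P)" and "\<beta> = real (card B)"
  have tA: "t \<le> card A" using diff_reps_le_card_left[OF fin(1), of B x] x by linarith
  have tB: "real t \<le> \<beta>" using diff_reps_le_card_right[OF fin(2), of A x] x by (simp add: \<beta>_def)
  have "A \<noteq> {}" using tA t by auto
  then obtain a where "a \<in> A" by auto
  have T\<pi>: "T \<le> \<pi>"
    using reps[OF \<open>a \<in> A\<close>] ratio_reps_le_card[OF fin(3) P(1), of P a] by (simp add: \<pi>_def)
  have t\<pi>: "real t \<le> \<pi>" using tA P(2) by (simp add: \<pi>_def)
  have pos: "d > 0" "\<pi> > 0" "\<beta> > 0" "real t > 0" "T > 0"
    using finD False T T\<pi> tB t by (auto simp: d_def D_def card_gt_0_iff)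
  have "(\<Sum>x\<in>D. t) \<le> (\<Sum>x\<in>D. diff_reps A B x)" by (rule sum_mono) (simp add: D_def)
  then have "card D * t \<le> card A * card B" using sum_diff_reps_le[OF fin(1,2) finD] by simp
  also have "\<dots> \<le> card P * card B" using P(2) by simp
  finally have "real (card D * t) \<le> real (card P * card B)" by (rule of_nat_mono)
  then have dt: "d * t \<le> \<pi> * \<beta>" by (simp add: d_def \<pi>_def \<beta>_def)
  \<comment> \<open>The largest cutting parameter for which the line term
    \<open>2 r \<pi> \<beta>\<close> is still at most half of the incidence count
    \<open>d t T\<close>.\<close>
  define \<rho> where "\<rho> = d * t * T / (4 * \<pi> * \<beta>)"
  have main: "d * (t * T) ^ 3 \<le> 512 * \<pi> ^ 4 * \<beta>\<^sup>2"
  proof (cases "\<rho> \<ge> 1")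
    case True
    define r where "r = nat \<lfloor>\<rho>\<rfloor>"
    have r: "r > 0" "real r \<le> \<rho>" "\<rho> \<le> 2 * real r"
    proof -
      have "\<lfloor>\<rho>\<rfloor> \<ge> 1" using True by simp
      then have "r > 0" "real r = of_int \<lfloor>\<rho>\<rfloor>" by (auto simp: r_def)
      then show "r > 0" "real r \<le> \<rho>" "\<rho> \<le> 2 * real r" by linarith+
    qed
    \<comment> \<open>The cutting needs \<open>r \<le> |D|\<close> and \<open>r \<le> |U|\<close>.
      The first follows from \<open>t T \<le> \<beta> \<pi>\<close>, the second from
      \<open>d t \<le> \<pi> \<beta>\<close> and \<open>T \<le> \<pi>\<close>.\<close>
    have "t * T \<le> \<beta> * \<pi>" using tB T\<pi> pos by (intro mult_mono) auto
    then have "t * T \<le> 4 * (\<beta> * \<pi>)" using mult_pos_pos[OF pos(3,2)] by linarith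
    then have "d * (t * T) \<le> d * (4 * (\<beta> * \<pi>))" using pos by (intro mult_left_mono) auto
    then have "\<rho> \<le> d" using pos by (simp add: \<rho>_def field_simps)
    then have rD: "r \<le> card D" using r by (simp add: d_def)
    have "d * t * T \<le> \<pi> * \<beta> * (4 * \<pi>)" by (rule mult_mono) (use dt T\<pi> pos in auto)
    then have "\<rho> \<le> \<pi>" using pos by (simp add: \<rho>_def field_simps)
    then have rU: "r \<le> card (inverse ` P)" using r
      by (simp add: \<pi>_def card_image inj_on_def)
    have cU: "card (inverse ` P) = card P" by (simp add: card_image inj_on_def)
    have "d * t * T \<le> 2 * r * \<pi> * \<beta> + 4 * d\<^sup>2 * \<pi>\<^sup>2 / r\<^sup>2"
    proof -
      have "card D * t * T
        \<le> real (\<Sum>(p, b)\<in>P \<times> B. card {(x, u) \<in> D \<times> inverse ` P. x + b = p * u})"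
        by (rule popular_differences_incidences[OF fin finD P(1) reps])
          (use T in \<open>auto simp: D_def\<close>)
      also have "\<dots> \<le> 2 * r * card P * card B + 4 * (card D)\<^sup>2 * (card (inverse ` P))\<^sup>2 / r\<^sup>2"
        using grid_incidence_bound[OF finD finite_imageI[OF fin(3)] fin(3,2) r(1) rD rU] by simp
      finally show ?thesis by (simp add: d_def \<pi>_def \<beta>_def cU)
    qed
    moreover have "2 * r * \<pi> * \<beta> \<le> d * t * T / 2"
      using r(2) pos by (simp add: \<rho>_def field_simps)
    \<comment> \<open>With the line term absorbed, the cell term dominates; inserting
      \<open>r \<ge> \<rho> / 2\<close> cancels \<open>d^2\<close> and leaves a bound for
      \<open>d\<close>.\<close>
    ultimately have "d * t * T / 2 \<le> 4 * d\<^sup>2 * \<pi>\<^sup>2 / r\<^sup>2" by linarith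
    also have "\<dots> \<le> 4 * d\<^sup>2 * \<pi>\<^sup>2 / (\<rho> / 2)\<^sup>2"
      using r True pos by (intro divide_left_mono power_mono mult_pos_pos) auto
    also have "\<dots> = 256 * \<pi> ^ 4 * \<beta>\<^sup>2 / (t * T)\<^sup>2"
      using pos by (simp add: \<rho>_def field_simps power2_eq_square power4_eq_xxxx)
    finally have "d * t * T * (t * T)\<^sup>2 \<le> 512 * \<pi> ^ 4 * \<beta>\<^sup>2"
      using pos by (simp add: field_simps)
    then show ?thesis by (simp add: power2_eq_square power3_eq_cube mult_ac)
  next
    case False
    \<comment> \<open>Here no cutting is possible, but \<open>\<rho> < 1\<close> already bounds
      \<open>d t T\<close>, and the trivial bounds on \<open>t\<close> and \<open>T\<close> supply
      the remaining factor \<open>(t T)^2\<close>.\<close>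
    then have "d * (t * T) \<le> 4 * \<pi> * \<beta>" using pos by (simp add: \<rho>_def field_simps)
    moreover have "(t * T)\<^sup>2 \<le> \<pi> ^ 3 * \<beta>"
    proof -
      have "(t * T)\<^sup>2 = (T * T) * (real t * real t)" by (simp add: power2_eq_square)
      also have "\<dots> \<le> (\<pi> * \<pi>) * (\<pi> * \<beta>)" using T\<pi> t\<pi> tB pos by (intro mult_mono) auto
      finally show ?thesis by (simp add: power3_eq_cube mult_ac)
    qed
    ultimately have "d * (t * T) * (t * T)\<^sup>2 \<le> (4 * \<pi> * \<beta>) * (\<pi> ^ 3 * \<beta>)"
      by (rule mult_mono) (use pos in auto)
    also have "\<dots> \<le> 512 * \<pi> ^ 4 * \<beta>\<^sup>2"
      using pos by (simp add: power2_eq_square power3_eq_cube power4_eq_xxxx)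
    finally show ?thesis by (simp add: power2_eq_square power3_eq_cube mult_ac)
  qed
  then show ?thesis
    using pos by (simp add: D_def d_def \<pi>_def \<beta>_def field_simps power_mult_distrib)
qed


section \<open>Moments of the number of representations\<close>

text \<open>A discrete mean value inequality, whose telescoped form bounds powers by sums over
  thresholds. The factor \<open>k\<close> makes the truncated \<open>k - 1\<close> harmless at
  \<open>k = 0\<close>.\<close>

lemma Suc_power_le: "Suc f ^ k \<le> f ^ k + k * Suc f ^ (k - 1)"
proof (induction k)
  case (Suc k)
  have "Suc f ^ Suc k \<le> Suc f * (f ^ k + k * Suc f ^ (k - 1))"
    using Suc by (simp only: power_Suc) (rule mult_le_mono2)
  also have "\<dots> = f ^ Suc k + (f ^ k + k * (Suc f * Suc f ^ (k - 1)))"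
    by (simp add: algebra_simps)
  also have "k * (Suc f * Suc f ^ (k - 1)) = k * Suc f ^ k"
    by (cases k) auto
  also have "f ^ k \<le> Suc f ^ k" by (rule power_mono) auto
  finally show ?case by (simp add: algebra_simps)
qed simp

lemma power_le_sum_layers: "f ^ k \<le> (\<Sum>t=1..f. k * t ^ (k - 1))" if "k > 0"
proof (induction f)
  case (Suc f)
  then show ?case using Suc_power_le[of f k] by simp
qed (use that in simp)

text \<open>Layer-cake summation: each power is bounded by a sum over the thresholds
  \<open>t \<le> f x\<close>, and exchanging the sums turns elements into level sets.\<close>

lemma sum_power_le_layers:
  assumes "finite X" "k > 0" "\<And>x. x \<in> X \<Longrightarrow> f x \<le> n"
  shows "(\<Sum>x\<in>X. f x ^ k) \<le> (\<Sum>t=1..n. k * t ^ (k - 1) * card {x\<in>X. f x \<ge> t})"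
proof -
  have "(\<Sum>x\<in>X. f x ^ k) \<le> (\<Sum>x\<in>X. \<Sum>t=1..n. if t \<le> f x then k * t ^ (k - 1) else 0)"
  proof (rule sum_mono)
    fix x assume "x \<in> X"
    then have "{1..n} \<inter> {t. t \<le> f x} = {1..f x}" using assms(3)[of x] by auto
    then show "f x ^ k \<le> (\<Sum>t=1..n. if t \<le> f x then k * t ^ (k - 1) else 0)"
      using power_le_sum_layers[OF assms(2), of "f x"] by (simp add: sum.If_cases)
  qed
  also have "\<dots> = (\<Sum>t=1..n. \<Sum>x\<in>X. if t \<le> f x then k * t ^ (k - 1) else 0)"
    by (rule sum.swap)
  also have "\<dots> = (\<Sum>t=1..n. k * t ^ (k - 1) * card {x\<in>X. f x \<ge> t})"
    using assms(1) by (simp add: sum.If_cases Int_def mult_ac)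
  finally show ?thesis .
qed

section \<open>Logarithmic sums and third moments\<close>

definition harmonic :: "nat \<Rightarrow> real" where
  "harmonic n = (\<Sum>t=1..n. inverse (real t))"

lemma harmonic_nonneg: "harmonic n \<ge> 0"
  unfolding harmonic_def by (intro sum_nonneg) auto

lemma harmonic_le_one_add_ln: "n > 0 \<Longrightarrow> harmonic n \<le> 1 + ln (real n)"
proof (induction n rule: nat_induct_non_zero)
  case (Suc n)
  have "ln (real n / real (Suc n)) \<le> real n / real (Suc n) - 1"
    using Suc by (intro ln_le_minus_one) auto
  then have "inverse (real (Suc n)) \<le> ln (real (Suc n)) - ln (real n)"
    using Suc by (simp add: ln_div field_simps)
  then show ?case using Suc by (simp add: harmonic_def)
qed (simp add: harmonic_def)

text \<open>Isolates the incidence estimate, so that the additive argument sees the ratio set and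
  \<open>T\<close> only through \<open>K\<close>. The set \<open>B\<close> stays free because it
  will be \<open>A\<close>, \<open>A + A\<close> and a set of popular differences.\<close>

definition popular_bound :: "real set \<Rightarrow> real \<Rightarrow> bool" where
  "popular_bound A K \<longleftrightarrow> (\<forall>B t. finite B \<longrightarrow> t > 0 \<longrightarrow>
     real (card {x. diff_reps A B x \<ge> t}) * t ^ 3 \<le> K * (card B)\<^sup>2)"

lemma popular_boundD:
  "popular_bound A K \<Longrightarrow> finite B \<Longrightarrow> t > 0 \<Longrightarrow>
     real (card {x. diff_reps A B x \<ge> t}) * t ^ 3 \<le> K * (card B)\<^sup>2"
  by (simp add: popular_bound_def)

text \<open>The third moment is the critical one: the weight \<open>t^2\<close> against level sets
  of size \<open>K |B|^2 / t^3\<close> leaves \<open>1 / t\<close>, so only a logarithm is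
  lost.\<close>

lemma sum_cube_diff_reps_le:
  fixes K :: real
  assumes "finite A" "finite B" "finite X" "popular_bound A K"
  shows "(\<Sum>x\<in>X. real (diff_reps A B x) ^ 3) \<le> 3 * K * (real (card B))\<^sup>2 * harmonic (card A)"
proof -
  have "(\<Sum>x\<in>X. diff_reps A B x ^ 3)
      \<le> (\<Sum>t=1..card A. 3 * t ^ (3 - 1) * card {x\<in>X. diff_reps A B x \<ge> t})"
    by (rule sum_power_le_layers) (use assms diff_reps_le_card_left in auto)
  then have "real (\<Sum>x\<in>X. diff_reps A B x ^ 3)
      \<le> real (\<Sum>t=1..card A. 3 * t\<^sup>2 * card {x\<in>X. diff_reps A B x \<ge> t})"
    by (intro of_nat_mono) simp
  also have "\<dots> = (\<Sum>t=1..card A. 3 * real t ^ 2 * real (card {x\<in>X. diff_reps A B x \<ge> t}))"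
    by simp
  also have "\<dots> \<le> (\<Sum>t=1..card A. 3 * K * (card B)\<^sup>2 * inverse (real t))"
  proof (rule sum_mono)
    fix t assume "t \<in> {1..card A}"
    then have t: "t > 0" by simp
    have "card {x\<in>X. diff_reps A B x \<ge> t} \<le> card {x. diff_reps A B x \<ge> t}"
      by (rule card_mono) (use finite_popular_differences[OF assms(1,2) t] in auto)
    then have "real (card {x\<in>X. diff_reps A B x \<ge> t}) * t ^ 3
        \<le> real (card {x. diff_reps A B x \<ge> t}) * t ^ 3"
      by (intro mult_right_mono) auto
    also have "\<dots> \<le> K * (card B)\<^sup>2" by (rule popular_boundD[OF assms(4,2) t])
    finally show "3 * real t ^ 2 * real (card {x\<in>X. diff_reps A B x \<ge> t})
        \<le> 3 * K * (card B)\<^sup>2 * inverse (real t)"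
      using t by (simp add: field_simps power2_eq_square power3_eq_cube)
  qed
  also have "\<dots> = 3 * K * (card B)\<^sup>2 * harmonic (card A)"
    unfolding harmonic_def by (simp add: sum_distrib_left)
  finally show ?thesis by simp
qed

text \<open>Hoelder with exponents 2, 6, 3, obtained from three applications of Cauchy--Schwarz.\<close>

lemma sum_mult_power6_le:
  fixes u v :: "'a \<Rightarrow> real"
  assumes "\<And>x. x \<in> X \<Longrightarrow> u x \<ge> 0" "\<And>x. x \<in> X \<Longrightarrow> v x \<ge> 0"
  shows "(\<Sum>x\<in>X. u x * v x) ^ 6 \<le> (\<Sum>x\<in>X. u x) ^ 3 * (\<Sum>x\<in>X. u x ^ 3) * (\<Sum>x\<in>X. v x ^ 3)\<^sup>2"
proof -
  define W Y Z U V where "W = (\<Sum>x\<in>X. u x * v x)" and "Y = (\<Sum>x\<in>X. u x * v x ^ 2)"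
    and "Z = (\<Sum>x\<in>X. u x ^ 2 * v x)" and "U = (\<Sum>x\<in>X. u x ^ 3)" and "V = (\<Sum>x\<in>X. v x ^ 3)"
  have nn: "W \<ge> 0" "Y \<ge> 0" "Z \<ge> 0" "U \<ge> 0" "V \<ge> 0" "(\<Sum>x\<in>X. u x) \<ge> 0"
    unfolding W_def Y_def Z_def U_def V_def using assms by (auto intro!: sum_nonneg)
  have 1: "W\<^sup>2 \<le> (\<Sum>x\<in>X. u x) * Y"
    unfolding W_def Y_def by (rule Cauchy_Schwarz_sum) (use assms in \<open>auto simp: power2_eq_square\<close>)
  have 2: "Y\<^sup>2 \<le> V * Z"
    unfolding V_def Y_def Z_def
    by (rule Cauchy_Schwarz_sum) (use assms in \<open>auto simp: power2_eq_square power3_eq_cube\<close>)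
  have 3: "Z\<^sup>2 \<le> U * Y"
    unfolding U_def Y_def Z_def
    by (rule Cauchy_Schwarz_sum) (use assms in \<open>auto simp: power2_eq_square power3_eq_cube\<close>)
  \<comment> \<open>Eliminating \<open>Z\<close> gives
    \<open>Y^4 \<le> V^2 Z^2 \<le> V^2 U Y\<close>; one factor \<open>Y\<close> is cancelled, hence
    the case split.\<close>
  have "Y ^ 3 \<le> U * V\<^sup>2"
  proof (cases "Y = 0")
    case False
    have "Y * Y ^ 3 = (Y\<^sup>2)\<^sup>2" by (simp add: power2_eq_square power3_eq_cube)
    also have "\<dots> \<le> (V * Z)\<^sup>2" using 2 nn by (intro power_mono) auto
    also have "\<dots> \<le> V\<^sup>2 * (U * Y)" unfolding power_mult_distrib using 3 by (intro mult_left_mono) auto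
    finally have "Y * Y ^ 3 \<le> Y * (U * V\<^sup>2)" by (simp add: mult_ac)
    then show ?thesis using False nn by (simp add: mult_le_cancel_left)
  qed (use nn in auto)
  have "W ^ 6 = (W\<^sup>2) ^ 3" by (simp flip: power_mult)
  also have "\<dots> \<le> ((\<Sum>x\<in>X. u x) * Y) ^ 3" using 1 by (intro power_mono) auto
  also have "\<dots> = (\<Sum>x\<in>X. u x) ^ 3 * Y ^ 3" by (simp add: power_mult_distrib)
  also have "\<dots> \<le> (\<Sum>x\<in>X. u x) ^ 3 * (U * V\<^sup>2)"
    using \<open>Y ^ 3 \<le> U * V\<^sup>2\<close> nn by (intro mult_left_mono) auto
  finally show ?thesis by (simp add: W_def U_def V_def mult_ac)
qed

section \<open>Additive energy and collisions of triples\<close>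

lemma diff_reps_self_pos_finite: "finite A \<Longrightarrow> finite {z. diff_reps A A z > 0}"
  using finite_popular_differences[of A A 1] by (simp add: Suc_le_eq)

text \<open>Cauchy-Schwarz for the addition map, with \<open>a + b = c + d\<close> rewritten as
  \<open>a - c = d - b\<close> to reach the second moment of differences. The superset
  \<open>C\<close> allows a refined subset of the original set to be used with the original
  sumset.\<close>

lemma card_power4_le_energy:
  fixes A :: "real set"
  assumes "finite A" "A \<subseteq> C" "finite C"
  shows "card A ^ 4 \<le> card (C + C) * (\<Sum>z | diff_reps A A z > 0. diff_reps A A z ^ 2)"
proof -
  let ?f = "\<lambda>(a, b). a + b :: real"
  let ?F = "\<lambda>z. {a\<in>A. a - z \<in> A}"
  let ?X = "{z. diff_reps A A z > 0}"
  have mem: "z \<in> ?X" if "a \<in> A" "a - z \<in> A" for a z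
    using that assms(1) by (auto simp: diff_reps_def card_gt_0_iff)
  have "card A ^ 4 = (card (A \<times> A))\<^sup>2"
    by (simp add: card_cartesian_product power2_eq_square power4_eq_xxxx)
  also have "\<dots> \<le> card (?f ` (A \<times> A)) * card {(x, y) \<in> (A \<times> A) \<times> (A \<times> A). ?f x = ?f y}"
    by (rule card_image_collisions_Cauchy_Schwarz) (use assms in auto)
  also have "\<dots> \<le> card (C + C) * (\<Sum>z\<in>?X. diff_reps A A z ^ 2)"
  proof (rule mult_le_mono)
    show "card (?f ` (A \<times> A)) \<le> card (C + C)"
      by (rule card_mono) (use assms in \<open>auto intro!: set_plus_intro finite_set_plus\<close>)
    have "card {(x, y) \<in> (A \<times> A) \<times> (A \<times> A). ?f x = ?f y} \<le> card (SIGMA z:?X. ?F z \<times> ?F z)"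
    proof (rule card_inj_on_le[of "\<lambda>((a, b), (c, d)). (a - c, a, d)"])
      show "inj_on (\<lambda>((a, b), (c, d)). (a - c, a, d)) {(x, y) \<in> (A \<times> A) \<times> (A \<times> A). ?f x = ?f y}"
        by (auto simp: inj_on_def)
      show "(\<lambda>((a, b), (c, d)). (a - c, a, d)) ` {(x, y) \<in> (A \<times> A) \<times> (A \<times> A). ?f x = ?f y}
          \<subseteq> (SIGMA z:?X. ?F z \<times> ?F z)"
      proof (clarsimp, goal_cases)
        case (1 a b c d)
        then have "d - (a - c) = b" by simp
        then have "d - (a - c) \<in> A" using 1 by (simp only:)
        then show ?case using 1 mem[of a "a - c"] by simp
      qed
      show "finite (SIGMA z:?X. ?F z \<times> ?F z)"
        using diff_reps_self_pos_finite[OF assms(1)] assms(1) by (intro finite_SigmaI) auto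
    qed
    also have "\<dots> = (\<Sum>z\<in>?X. diff_reps A A z ^ 2)"
      using diff_reps_self_pos_finite[OF assms(1)] assms(1)
      by (subst card_SigmaI) (auto simp: card_cartesian_product power2_eq_square diff_reps_def)
    finally show "card {(x, y) \<in> (A \<times> A) \<times> (A \<times> A). ?f x = ?f y} \<le> (\<Sum>z\<in>?X. diff_reps A A z ^ 2)" .
  qed
  finally show ?thesis .
qed

text \<open>A collision of \<open>(a, b, c)\<close> with \<open>(a', b', c')\<close> means
  \<open>a' - a = b - b' = c' - c\<close>. It is therefore a difference together with three of its
  representations.\<close>

lemma card_triple_collisions_le:
  fixes A :: "real set"
  assumes "finite A" "X \<subseteq> A \<times> A \<times> A"
  shows "card {(p, q) \<in> X \<times> X. (\<lambda>(a, b, c). (a + b, b + c)) p = (\<lambda>(a, b, c). (a + b, b + c)) q}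
    \<le> (\<Sum>z | diff_reps A A z > 0. diff_reps A A z ^ 3)"
    (is "card ?C \<le> _")
proof -
  let ?F = "\<lambda>z. {a\<in>A. a - z \<in> A}"
  let ?X = "{z. diff_reps A A z > 0}"
  let ?g = "\<lambda>((a, b, c), (a', b', c')). (a' - a, a', b, c')"
  have mem: "z \<in> ?X" if "a \<in> A" "a - z \<in> A" for a z
    using that assms(1) by (auto simp: diff_reps_def card_gt_0_iff)
  have "card ?C \<le> card (SIGMA z:?X. ?F z \<times> ?F z \<times> ?F z)"
  proof (rule card_inj_on_le[of ?g])
    show "inj_on ?g ?C" by (auto simp: inj_on_def)
    show "?g ` ?C \<subseteq> (SIGMA z:?X. ?F z \<times> ?F z \<times> ?F z)"
    proof
      fix w assume "w \<in> ?g ` ?C"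
      then obtain a b c a' b' c' where
        w: "w = (a' - a, a', b, c')" and X: "(a, b, c) \<in> X" "(a', b', c') \<in> X"
        and eq: "a + b = a' + b'" "b + c = b' + c'" by auto
      have in_A: "a \<in> A" "b \<in> A" "c \<in> A" "a' \<in> A" "b' \<in> A" "c' \<in> A"
        using X assms(2) by auto
      moreover have "b - (a' - a) = b'" "c' - (a' - a) = c" using eq by auto
      ultimately show "w \<in> (SIGMA z:?X. ?F z \<times> ?F z \<times> ?F z)"
        using mem[of a' "a' - a"] by (simp add: w)
    qed
    show "finite (SIGMA z:?X. ?F z \<times> ?F z \<times> ?F z)"
      using diff_reps_self_pos_finite[OF assms(1)] assms(1) by (intro finite_SigmaI) auto
  qed
  also have "\<dots> = (\<Sum>z\<in>?X. diff_reps A A z ^ 3)"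
    using diff_reps_self_pos_finite[OF assms(1)] assms(1)
    by (subst card_SigmaI) (auto simp: card_cartesian_product power3_eq_cube diff_reps_def mult.assoc)
  finally show ?thesis .
qed


section \<open>Popular sums\<close>

definition sum_reps :: "real set \<Rightarrow> real \<Rightarrow> nat" where
  "sum_reps A x = card {a\<in>A. x - a \<in> A}"

text \<open>The threshold is one sixth of the average number of representations, multiplied out to
  stay in the naturals. Pairs with an unpopular sum then make up at most one sixth of all
  pairs.\<close>

definition popular_sums :: "real set \<Rightarrow> real set" where
  "popular_sums A = {x \<in> A + A. (card A)\<^sup>2 \<le> 6 * card (A + A) * sum_reps A x}"

text \<open>Discard the elements having more than \<open>n / 3\<close> partners with an unpopular
  sum. As there are at most \<open>n^2 / 6\<close> such pairs, at most half of \<open>A\<close> is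
  lost, and two remaining elements together exclude at most \<open>2 n / 3\<close> partners.\<close>

lemma exists_subset_common_popular_sums:
  assumes "finite A"
  obtains A' where "A' \<subseteq> A" "card A \<le> 2 * card A'"
    "\<And>a c. a \<in> A' \<Longrightarrow> c \<in> A' \<Longrightarrow>
       card A \<le> 3 * card {b\<in>A. a + b \<in> popular_sums A \<and> b + c \<in> popular_sums A}"
proof (cases "A = {}")
  case True
  then show ?thesis using that[of "{}"] by simp
next
  case False
  define n s S where "n = card A" and "s = card (A + A)" and "S = popular_sums A"
  define bad where "bad = {(a, b) \<in> A \<times> A. a + b \<notin> S}"
  define d where "d a = card {b\<in>A. a + b \<notin> S}" for a
  define A' where "A' = {a\<in>A. 3 * d a \<le> n}"
  have finS: "finite (A + A)" by (rule finite_set_plus[OF assms assms])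
  have npos: "n > 0" using False assms by (simp add: n_def card_gt_0_iff)
  have spos: "s > 0" using False finS by (auto simp: s_def card_gt_0_iff set_plus_def)
  have finb: "finite bad"
    by (rule finite_subset[of _ "A \<times> A"]) (use assms in \<open>auto simp: bad_def\<close>)
  have "card bad = (\<Sum>x\<in>A + A. card {p\<in>bad. (\<lambda>(a, b). a + b) p = x})"
    by (rule card_eq_sum_card_fibers) (use finb finS in \<open>auto simp: bad_def intro!: set_plus_intro\<close>)
  then have "6 * s * card bad = (\<Sum>x\<in>A + A. 6 * s * card {p\<in>bad. (\<lambda>(a, b). a + b) p = x})"
    by (simp add: sum_distrib_left)
  also have "\<dots> \<le> (\<Sum>x\<in>A + A. n\<^sup>2)"
  proof (rule sum_mono)
    fix x assume x: "x \<in> A + A"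
    show "6 * s * card {p\<in>bad. (\<lambda>(a, b). a + b) p = x} \<le> n\<^sup>2"
    proof (cases "x \<in> S")
      case True
      then have "{p\<in>bad. (\<lambda>(a, b). a + b) p = x} = {}" by (auto simp: bad_def)
      then show ?thesis by (simp only:) simp
    next
      case False
      have "card {p\<in>bad. (\<lambda>(a, b). a + b) p = x} \<le> sum_reps A x"
        unfolding sum_reps_def
        by (rule card_inj_on_le[of fst]) (use assms in \<open>auto simp: bad_def inj_on_def\<close>)
      then have "6 * s * card {p\<in>bad. (\<lambda>(a, b). a + b) p = x} \<le> 6 * s * sum_reps A x"
        by (rule mult_le_mono2)
      also have "\<dots> \<le> n\<^sup>2"
        using False x unfolding S_def popular_sums_def s_def n_def by simp
      finally show ?thesis .
    qed
  qed
  finally have bad: "6 * card bad \<le> n\<^sup>2" using spos by (simp add: s_def)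
  have "card bad = (\<Sum>a\<in>A. card {p\<in>bad. fst p = a})"
    by (rule card_eq_sum_card_fibers) (use finb assms in \<open>auto simp: bad_def\<close>)
  also have "\<dots> = (\<Sum>a\<in>A. d a)"
  proof (rule sum.cong[OF refl])
    fix a assume "a \<in> A"
    then have "{p\<in>bad. fst p = a} = Pair a ` {b\<in>A. a + b \<notin> S}" by (auto simp: bad_def)
    then show "card {p\<in>bad. fst p = a} = d a" by (simp add: d_def card_image inj_on_def)
  qed
  finally have bad_eq: "card bad = (\<Sum>a\<in>A. d a)" .
  have "card (A - A') * n = (\<Sum>a\<in>A - A'. n)" by simp
  also have "\<dots> \<le> (\<Sum>a\<in>A - A'. 3 * d a)" by (rule sum_mono) (auto simp: A'_def)
  also have "\<dots> \<le> (\<Sum>a\<in>A. 3 * d a)" by (rule sum_mono2) (use assms in auto)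
  also have "\<dots> = 3 * card bad" by (simp add: bad_eq sum_distrib_left)
  finally have "2 * card (A - A') * n \<le> n * n" using bad unfolding power2_eq_square by linarith
  then have "2 * card (A - A') \<le> n" using npos by simp
  moreover have "card (A - A') + card A' = n"
    unfolding n_def using card_Diff_subset[of A' A] card_mono[of A A'] assms
    by (auto simp: A'_def intro: finite_subset)
  ultimately have half: "n \<le> 2 * card A'" by linarith
  have common: "n \<le> 3 * card {b\<in>A. a + b \<in> S \<and> b + c \<in> S}" if "a \<in> A'" "c \<in> A'" for a c
  proof -
    let ?G = "{b\<in>A. a + b \<in> S \<and> b + c \<in> S}"
    have "A \<subseteq> ?G \<union> ({b\<in>A. a + b \<notin> S} \<union> {b\<in>A. c + b \<notin> S})" by (auto simp: add.commute)
    then have "n \<le> card (?G \<union> ({b\<in>A. a + b \<notin> S} \<union> {b\<in>A. c + b \<notin> S}))"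
      unfolding n_def by (intro card_mono) (use assms in auto)
    also have "\<dots> \<le> card ?G + (d a + d c)"
      unfolding d_def by (meson card_Un_le add_left_mono order_trans)
    finally show ?thesis using that by (auto simp: A'_def)
  qed
  show ?thesis
    by (rule that[of A']) (use half common in \<open>auto simp: A'_def n_def S_def\<close>)
qed

text \<open>Each popular \<open>x\<close> has many representations \<open>x = a + b\<close>. For a
  pair \<open>(x, y)\<close> put \<open>z = b - y\<close>: this represents \<open>z\<close> in
  \<open>A - (A + A)\<close>, while \<open>- z = a - (x - y)\<close> represents \<open>- z\<close>
  in \<open>A - P\<close>.\<close>

lemma card_popular_sum_pairs_le:
  fixes A P :: "real set"
  assumes "finite A"
  shows "(card A)\<^sup>2 * card {(x, y) \<in> popular_sums A \<times> popular_sums A. x - y \<in> P}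
    \<le> 6 * card (A + A) *
      (\<Sum>z | diff_reps A (A + A) z > 0. diff_reps A P (- z) * diff_reps A (A + A) z)"
proof -
  define S where "S = popular_sums A"
  define X where "X = {z. diff_reps A (A + A) z > 0}"
  define Q where "Q = {(x, y) \<in> S \<times> S. x - y \<in> P}"
  define H where "H z = {a\<in>A. a - (- z) \<in> P} \<times> {b\<in>A. b - z \<in> A + A}" for z
  have finS: "finite (A + A)" by (rule finite_set_plus[OF assms assms])
  have SS: "S \<subseteq> A + A" by (auto simp: S_def popular_sums_def)
  have finQ: "finite Q"
    by (rule finite_subset[of _ "S \<times> S"])
      (use finite_subset[OF SS finS] in \<open>auto simp: Q_def\<close>)
  have finX: "finite X"
    using finite_popular_differences[OF assms finS, of 1] by (simp add: X_def Suc_le_eq)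
  have "(card A)\<^sup>2 * card Q = (\<Sum>q\<in>Q. (card A)\<^sup>2)" by simp
  also have "\<dots> \<le> (\<Sum>q\<in>Q. 6 * card (A + A) * sum_reps A (fst q))"
    by (rule sum_mono) (auto simp: Q_def S_def popular_sums_def)
  also have "\<dots> = 6 * card (A + A) * (\<Sum>q\<in>Q. sum_reps A (fst q))"
    by (simp add: sum_distrib_left)
  also have "(\<Sum>q\<in>Q. sum_reps A (fst q)) = card (SIGMA q:Q. {a\<in>A. fst q - a \<in> A})"
    unfolding sum_reps_def using finQ assms by (subst card_SigmaI) auto
  also have "\<dots> \<le> card (SIGMA z:X. H z)"
  proof (rule card_inj_on_le[of "\<lambda>((x, y), a). (x - a - y, a, x - a)"])
    show "inj_on (\<lambda>((x, y), a). (x - a - y, a, x - a)) (SIGMA q:Q. {a\<in>A. fst q - a \<in> A})"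
      by (auto simp: inj_on_def)
    show "(\<lambda>((x, y), a). (x - a - y, a, x - a)) ` (SIGMA q:Q. {a\<in>A. fst q - a \<in> A}) \<subseteq> (SIGMA z:X. H z)"
    proof
      fix w assume "w \<in> (\<lambda>((x, y), a). (x - a - y, a, x - a)) ` (SIGMA q:Q. {a\<in>A. fst q - a \<in> A})"
      then obtain x y a where w: "w = (x - a - y, a, x - a)" "(x, y) \<in> Q" "a \<in> A" "x - a \<in> A"
        by auto
      have y: "y \<in> A + A" using w(2) SS by (auto simp: Q_def)
      have "x - a \<in> {b\<in>A. b - (x - a - y) \<in> A + A}" using w(4) y by simp
      then have "x - a - y \<in> X"
        unfolding X_def diff_reps_def using assms by (auto simp: card_gt_0_iff)
      then show "w \<in> (SIGMA z:X. H z)" using w y by (auto simp: H_def Q_def)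
    qed
    show "finite (SIGMA z:X. H z)" using finX assms by (intro finite_SigmaI) (auto simp: H_def)
  qed
  also have "\<dots> = (\<Sum>z\<in>X. diff_reps A P (- z) * diff_reps A (A + A) z)"
    using finX assms
    by (subst card_SigmaI) (auto simp: H_def diff_reps_def card_cartesian_product)
  finally show ?thesis by (simp add: Q_def S_def X_def)
qed

text \<open>Hoelder separates the correlation into the first and third moments for \<open>P\<close>
  and the third moment for \<open>A + A\<close>; the third moments are controlled by
  \<open>K\<close>.\<close>

lemma popular_sum_pairs_moment_le:
  fixes A P :: "real set" and K :: real
  assumes fin: "finite A" "finite P" and K: "popular_bound A K"
  defines "\<Omega> \<equiv> \<Sum>z | diff_reps A (A + A) z > 0. real (diff_reps A P (- z)) * real (diff_reps A (A + A) z)"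
  shows "\<Omega> ^ 6 \<le> (real (card A) * real (card P)) ^ 3 * (3 * K * (real (card P))\<^sup>2 * harmonic (card A)) *
    (3 * K * (real (card (A + A)))\<^sup>2 * harmonic (card A))\<^sup>2"
proof -
  define X where "X = {z. diff_reps A (A + A) z > 0}"
  have finS: "finite (A + A)" by (rule finite_set_plus[OF fin(1) fin(1)])
  have finX: "finite X"
    using finite_popular_differences[OF fin(1) finS, of 1] by (simp add: X_def Suc_le_eq)
  \<comment> \<open>The representations in \<open>A - P\<close> are evaluated at \<open>- z\<close>,
    so the range is reflected before the moment bounds are used.\<close>
  have refl: "(\<Sum>z\<in>X. f (- z)) = (\<Sum>z\<in>uminus ` X. f z)" for f :: "real \<Rightarrow> real"
    by (simp add: sum.reindex inj_on_def)
  have "\<Omega> ^ 6 \<le> (\<Sum>z\<in>X. real (diff_reps A P (- z))) ^ 3 * (\<Sum>z\<in>X. real (diff_reps A P (- z)) ^ 3) *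
      (\<Sum>z\<in>X. real (diff_reps A (A + A) z) ^ 3)\<^sup>2"
    unfolding \<Omega>_def X_def by (rule sum_mult_power6_le) auto
  also have "\<dots> \<le> (real (card A) * real (card P)) ^ 3 * (3 * K * (real (card P))\<^sup>2 * harmonic (card A)) *
    (3 * K * (real (card (A + A)))\<^sup>2 * harmonic (card A))\<^sup>2"
  proof (intro mult_mono power_mono)
    show "(\<Sum>z\<in>X. real (diff_reps A P (- z))) \<le> real (card A) * real (card P)"
      using of_nat_mono[OF sum_diff_reps_le[OF fin finite_imageI[OF finX, of uminus]], where 'a = real]
      unfolding refl[of "\<lambda>z. real (diff_reps A P z)"] of_nat_sum of_nat_mult .
    show cube: "(\<Sum>z\<in>X. real (diff_reps A P (- z)) ^ 3) \<le> 3 * K * (real (card P))\<^sup>2 * harmonic (card A)"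
      unfolding refl[of "\<lambda>z. real (diff_reps A P z) ^ 3"]
      by (intro sum_cube_diff_reps_le) (use fin finX K in auto)
    show "(\<Sum>z\<in>X. real (diff_reps A (A + A) z) ^ 3) \<le> 3 * K * (real (card (A + A)))\<^sup>2 * harmonic (card A)"
      by (intro sum_cube_diff_reps_le) (use fin finX finS K in auto)
    have "0 \<le> (\<Sum>z\<in>X. real (diff_reps A P (- z)) ^ 3)" by (intro sum_nonneg) auto
    then show "0 \<le> (real (card A) * real (card P)) ^ 3 * (3 * K * (real (card P))\<^sup>2 * harmonic (card A))"
      using order_trans[OF _ cube] by (intro mult_nonneg_nonneg[OF zero_le_power]) auto
  qed (auto intro!: sum_nonneg)
  finally show ?thesis .
qed


section \<open>The sumset bound\<close>

text \<open>Choose a difference in \<open>P\<close>, one of its at least \<open>t\<close>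
  representations in \<open>A'\<close>, and then one of the at least \<open>k / 3\<close> common
  partners \<open>b\<close>.\<close>

lemma card_popular_triples_ge:
  fixes A A' P :: "real set"
  assumes "finite A" "A' \<subseteq> A" "finite P"
    and P: "\<And>x. x \<in> P \<Longrightarrow> t \<le> diff_reps A' A' x"
    and good: "\<And>a c. a \<in> A' \<Longrightarrow> c \<in> A' \<Longrightarrow> k \<le> 3 * card {b\<in>A. a + b \<in> S \<and> b + c \<in> S}"
  shows "card P * t * k \<le> 3 * card {(a, b, c) \<in> A' \<times> A \<times> A'. a - c \<in> P \<and> a + b \<in> S \<and> b + c \<in> S}"
proof -
  let ?F = "\<lambda>x. {a\<in>A'. a - x \<in> A'}"
  let ?G = "\<lambda>a c. {b\<in>A. a + b \<in> S \<and> b + c \<in> S}"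
  let ?R = "{(a, b, c) \<in> A' \<times> A \<times> A'. a - c \<in> P \<and> a + b \<in> S \<and> b + c \<in> S}"
  have finA': "finite A'" using assms finite_subset by blast
  have finR: "finite ?R"
    by (rule finite_subset[of _ "A' \<times> A \<times> A'"]) (use assms finA' in auto)
  have "card P * t * k = (\<Sum>x\<in>P. t * k)" by simp
  also have "\<dots> \<le> (\<Sum>x\<in>P. \<Sum>a\<in>?F x. 3 * card (?G a (a - x)))"
  proof (rule sum_mono)
    fix x assume "x \<in> P"
    have "t * k \<le> (\<Sum>a\<in>?F x. k)" using P[OF \<open>x \<in> P\<close>] by (simp add: diff_reps_def)
    also have "\<dots> \<le> (\<Sum>a\<in>?F x. 3 * card (?G a (a - x)))"
      by (rule sum_mono) (use good in auto)
    finally show "t * k \<le> (\<Sum>a\<in>?F x. 3 * card (?G a (a - x)))" .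
  qed
  also have "\<dots> = 3 * card (SIGMA x:P. SIGMA a:?F x. ?G a (a - x))"
    using assms finA' by (simp add: sum_distrib_left finite_SigmaI)
  also have "card (SIGMA x:P. SIGMA a:?F x. ?G a (a - x)) \<le> card ?R"
    by (rule card_inj_on_le[of "\<lambda>(x, a, b). (a, b, a - x)", OF _ _ finR])
      (auto simp: inj_on_def)
  finally show ?thesis by simp
qed

text \<open>The identity \<open>(a + b) - (b + c) = a - c\<close>, with both sums and the difference popular, is
  counted twice: the fibres of \<open>(a, b, c) \<mapsto> (a + b, b + c)\<close> are controlled by the third moment of
  \<open>diff_reps A A\<close>, and its image by incidences.\<close>

lemma popular_level_set_bound:
  fixes A A' P :: "real set" and K :: real
  assumes fin: "finite A" "finite P" and sub: "A' \<subseteq> A" and ne: "A \<noteq> {}" and K: "popular_bound A K"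
    and P: "\<And>x. x \<in> P \<Longrightarrow> t \<le> diff_reps A' A' x" and t: "t > 0"
    and good: "\<And>a c. a \<in> A' \<Longrightarrow> c \<in> A' \<Longrightarrow>
       card A \<le> 3 * card {b\<in>A. a + b \<in> popular_sums A \<and> b + c \<in> popular_sums A}"
  shows "(card P * real t ^ 2) ^ 9 * card A ^ 5
    \<le> 27 * 162 ^ 6 * real (card (A + A)) ^ 10 * K ^ 11 * harmonic (card A) ^ 9"
proof -
  define S where "S = popular_sums A"
  define R where "R = {(a, b, c) \<in> A' \<times> A \<times> A'. a - c \<in> P \<and> a + b \<in> S \<and> b + c \<in> S}"
  define Q where "Q = {(x, y) \<in> S \<times> S. x - y \<in> P}"
  define f where "f = (\<lambda>(a, b, c). (a + b, b + c) :: real \<times> real)"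
  define n s m h where "n = real (card A)" and "s = real (card (A + A))"
    and "m = real (card P)" and "h = harmonic (card A)"
  define \<Omega> where "\<Omega> = (\<Sum>z | diff_reps A (A + A) z > 0. real (diff_reps A P (- z)) * real (diff_reps A (A + A) z))"
  have finS: "finite S"
    by (rule finite_subset[OF _ finite_set_plus[OF fin(1) fin(1)]]) (auto simp: S_def popular_sums_def)
  have finQ: "finite Q" by (rule finite_subset[of _ "S \<times> S"]) (use finS in \<open>auto simp: Q_def\<close>)
  have "finite A'" using sub fin finite_subset by blast
  then have finR: "finite R"
    using fin by (intro finite_subset[of R "A' \<times> A \<times> A'"]) (auto simp: R_def)
  have npos: "n > 0" using ne fin by (simp add: n_def card_gt_0_iff)
  have nn: "s \<ge> 0" "m \<ge> 0" "h \<ge> 0" "\<Omega> \<ge> 0"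
    by (auto simp: s_def m_def h_def \<Omega>_def harmonic_nonneg intro!: sum_nonneg)
  \<comment> \<open>The sign of \<open>K\<close> is read off from its bound at \<open>B = A\<close>
    and \<open>t = 1\<close>.\<close>
  have "real (card {x. diff_reps A A x \<ge> 1}) \<le> K * n\<^sup>2"
    using popular_boundD[OF K fin(1), of 1] by (simp add: n_def)
  then have "0 \<le> K * n\<^sup>2" by (rule order_trans[OF of_nat_0_le_iff])
  then have Kn: "K \<ge> 0" using npos by (simp add: zero_le_mult_iff)

  have "card P * t * card A \<le> 3 * card R"
    unfolding R_def S_def by (rule card_popular_triples_ge) (use fin sub P good in auto)
  then have "real (card P * t * card A) \<le> real (3 * card R)" by (rule of_nat_mono)
  then have r1: "m * t * n \<le> 3 * card R" by (simp add: m_def n_def)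
  have "(card R)\<^sup>2 \<le> card (f ` R) * card {(x, y) \<in> R \<times> R. f x = f y}"
    by (rule card_image_collisions_Cauchy_Schwarz[OF finR])
  also have "\<dots> \<le> card Q * (\<Sum>z | diff_reps A A z > 0. diff_reps A A z ^ 3)"
  proof (rule mult_le_mono)
    show "card (f ` R) \<le> card Q"
      by (rule card_mono[OF finQ]) (auto simp: R_def Q_def f_def)
    show "card {(x, y) \<in> R \<times> R. f x = f y} \<le> (\<Sum>z | diff_reps A A z > 0. diff_reps A A z ^ 3)"
      unfolding f_def by (rule card_triple_collisions_le) (use fin sub in \<open>auto simp: R_def\<close>)
  qed
  finally have "real ((card R)\<^sup>2) \<le> real (card Q * (\<Sum>z | diff_reps A A z > 0. diff_reps A A z ^ 3))"
    by (rule of_nat_mono)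
  then have "real (card R) ^ 2 \<le> card Q * (\<Sum>z | diff_reps A A z > 0. real (diff_reps A A z) ^ 3)"
    by simp
  also have "\<dots> \<le> card Q * (3 * K * n\<^sup>2 * h)"
    using sum_cube_diff_reps_le[OF fin(1,1) diff_reps_self_pos_finite[OF fin(1)] K]
    by (intro mult_left_mono) (auto simp: n_def h_def)
  finally have r2: "real (card R) ^ 2 \<le> card Q * (3 * K * n\<^sup>2 * h)" .
  have "real ((card A)\<^sup>2 * card Q) \<le> real (6 * card (A + A) *
      (\<Sum>z | diff_reps A (A + A) z > 0. diff_reps A P (- z) * diff_reps A (A + A) z))"
    unfolding Q_def S_def by (rule of_nat_mono[OF card_popular_sum_pairs_le[OF fin(1)]])
  then have r3: "n\<^sup>2 * card Q \<le> 6 * s * \<Omega>" by (simp add: n_def s_def \<Omega>_def)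
  have r4: "\<Omega> ^ 6 \<le> (n * m) ^ 3 * (3 * K * m\<^sup>2 * h) * (3 * K * s\<^sup>2 * h)\<^sup>2"
    using popular_sum_pairs_moment_le[OF fin K] by (simp add: \<Omega>_def n_def m_def s_def h_def)
  \<comment> \<open>Differences popular in \<open>A'\<close> are popular in \<open>A\<close>, so the
    incidence bound also controls \<open>m t^3\<close>.\<close>
  have "card P \<le> card {x. diff_reps A A x \<ge> t}"
  proof (rule card_mono)
    have "diff_reps A' A' x \<le> diff_reps A A x" for x
      unfolding diff_reps_def by (rule card_mono) (use fin sub in auto)
    then show "P \<subseteq> {x. diff_reps A A x \<ge> t}" using P order_trans by blast
  qed (rule finite_popular_differences[OF fin(1,1) t])
  then have "m * t ^ 3 \<le> real (card {x. diff_reps A A x \<ge> t}) * t ^ 3"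
    unfolding m_def by (intro mult_right_mono) auto
  also have "\<dots> \<le> K * n\<^sup>2" using popular_boundD[OF K fin(1) t] by (simp add: n_def)
  finally have r5: "m * real t ^ 3 \<le> K * n\<^sup>2" by simp

  have "(m * t * n)\<^sup>2 \<le> (3 * real (card R))\<^sup>2"
    using r1 nn npos by (intro power_mono) auto
  also have "\<dots> = 9 * real (card R) ^ 2" by (simp add: power_mult_distrib)
  also have "\<dots> \<le> 9 * (card Q * (3 * K * n\<^sup>2 * h))"
    using r2 by (rule mult_left_mono) simp
  also have "\<dots> = 27 * K * h * (n\<^sup>2 * card Q)" by simp
  also have "\<dots> \<le> 27 * K * h * (6 * s * \<Omega>)"
    using r3 Kn nn by (intro mult_left_mono) auto
  \<comment> \<open>The sixth power is taken because Hoelder bounds \<open>\<Omega> ^ 6\<close>;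
    afterwards the common factor \<open>n^3 m^5\<close> cancels.\<close>
  finally have "((m * t * n)\<^sup>2) ^ 6 \<le> (162 * K * h * s * \<Omega>) ^ 6"
    by (intro power_mono) (auto simp: mult_ac)
  also have "\<dots> = (162 * K * h * s) ^ 6 * \<Omega> ^ 6" by (simp add: power_mult_distrib)
  also have "\<dots> \<le> (162 * K * h * s) ^ 6 * ((n * m) ^ 3 * (3 * K * m\<^sup>2 * h) * (3 * K * s\<^sup>2 * h)\<^sup>2)"
    using r4 Kn nn by (intro mult_left_mono) auto
  also have "\<dots> = (n ^ 3 * m ^ 5) * (27 * 162 ^ 6 * s ^ 10 * K ^ 9 * h ^ 9)" by algebra
  also have "((m * t * n)\<^sup>2) ^ 6 = (n ^ 3 * m ^ 5) * (m ^ 7 * real t ^ 12 * n ^ 9)" by algebra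
  finally have "(n ^ 3 * m ^ 5) * (m ^ 7 * real t ^ 12 * n ^ 9)
      \<le> (n ^ 3 * m ^ 5) * (27 * 162 ^ 6 * s ^ 10 * K ^ 9 * h ^ 9)" .
  then have r6: "m ^ 7 * real t ^ 12 * n ^ 9 \<le> 27 * 162 ^ 6 * s ^ 10 * K ^ 9 * h ^ 9" if "m > 0"
    using npos that by (simp add: mult_le_cancel_left_pos)
  have "(m * real t ^ 2) ^ 9 * n ^ 5 \<le> 27 * 162 ^ 6 * s ^ 10 * K ^ 11 * h ^ 9"
  proof (cases "m = 0")
    case True
    then show ?thesis using nn Kn by simp
  next
    case False
    then have "m > 0" using nn by simp
    \<comment> \<open>Two factors \<open>m t^3\<close> turn \<open>m^7 t^12\<close> into
      \<open>(m t^2)^9\<close>, the quantity that enters the energy.\<close>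
    have "n ^ 4 * ((m * real t ^ 2) ^ 9 * n ^ 5) = (m ^ 7 * real t ^ 12 * n ^ 9) * (m * real t ^ 3)\<^sup>2"
      by algebra
    also have "\<dots> \<le> (27 * 162 ^ 6 * s ^ 10 * K ^ 9 * h ^ 9) * (K * n\<^sup>2)\<^sup>2"
      by (rule mult_mono[OF r6[OF \<open>m > 0\<close>] power_mono[OF r5]]) (use nn Kn in auto)
    also have "\<dots> = n ^ 4 * (27 * 162 ^ 6 * s ^ 10 * K ^ 11 * h ^ 9)"
      by algebra
    finally show ?thesis using npos by (simp add: mult_le_cancel_left_pos)
  qed
  then show ?thesis by (simp add: m_def n_def s_def h_def)
qed

text \<open>The energy of \<open>A'\<close> is at most \<open>2 h\<close> times the largest
  \<open>m t^2\<close> over its level sets. The ninth power of the resulting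
  \<open>n^4 \<le> 32 s e h\<close> is combined with the bound for \<open>e^9 n^5\<close>.\<close>

lemma sumset_bound_of_popular_bound:
  fixes A :: "real set" and K :: real
  assumes fin: "finite A" and ne: "A \<noteq> {}" and K: "popular_bound A K"
  shows "real (card A) ^ 41
    \<le> 32 ^ 9 * 27 * 162 ^ 6 * real (card (A + A)) ^ 19 * K ^ 11 * harmonic (card A) ^ 18"
proof -
  obtain A' where sub: "A' \<subseteq> A" and half: "card A \<le> 2 * card A'"
    and good: "\<And>a c. a \<in> A' \<Longrightarrow> c \<in> A' \<Longrightarrow>
       card A \<le> 3 * card {b\<in>A. a + b \<in> popular_sums A \<and> b + c \<in> popular_sums A}"
    using exists_subset_common_popular_sums[OF fin] by blast
  have finA': "finite A'" using sub fin finite_subset by blast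
  define n s h where "n = real (card A)" and "s = real (card (A + A))" and "h = harmonic (card A)"
  define X where "X = {z. diff_reps A' A' z > 0}"
  define m where "m t = real (card {x. diff_reps A' A' x \<ge> t})" for t
  \<comment> \<open>The maximum is attained at a single \<open>t\<close>, so the level-set bound
    applies to it directly and no dyadic decomposition is made.\<close>
  define e where "e = Max ((\<lambda>t. m t * real t ^ 2) ` {1..card A})"
  have n1: "card A \<ge> 1" using ne fin by (simp add: Suc_le_eq card_gt_0_iff)
  have finX: "finite X" unfolding X_def by (rule diff_reps_self_pos_finite[OF finA'])
  have e_in: "e \<in> (\<lambda>t. m t * real t ^ 2) ` {1..card A}"
    unfolding e_def using n1 by (intro Max_in) auto
  then have e: "e ^ 9 * n ^ 5 \<le> 27 * 162 ^ 6 * s ^ 10 * K ^ 11 * h ^ 9"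
    using popular_level_set_bound[OF fin finite_popular_differences[OF finA' finA'] sub ne K _ _ good]
    by (auto simp: m_def n_def s_def h_def)
  have e_nn: "e \<ge> 0" using e_in by (auto simp: m_def)
  have hs: "h \<ge> 0" "s \<ge> 0" by (auto simp: h_def s_def harmonic_nonneg)

  have "real (\<Sum>z\<in>X. diff_reps A' A' z ^ 2)
      \<le> real (\<Sum>t=1..card A. 2 * t ^ (2 - 1) * card {x\<in>X. diff_reps A' A' x \<ge> t})"
    using diff_reps_le_card_left[OF finA', of A'] card_mono[OF fin sub] finX
    by (intro of_nat_mono sum_power_le_layers) (auto intro: order_trans)
  also have "\<dots> = (\<Sum>t=1..card A. 2 * real t * real (card {x\<in>X. diff_reps A' A' x \<ge> t}))" by simp
  also have "\<dots> \<le> (\<Sum>t=1..card A. 2 * e * inverse (real t))"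
  proof (rule sum_mono)
    fix t assume t: "t \<in> {1..card A}"
    then have "t > 0" by simp
    have "card {x\<in>X. diff_reps A' A' x \<ge> t} \<le> card {x. diff_reps A' A' x \<ge> t}"
      by (rule card_mono) (use finite_popular_differences[OF finA' finA' \<open>t > 0\<close>] in auto)
    then have "real (card {x\<in>X. diff_reps A' A' x \<ge> t}) * real t ^ 2 \<le> m t * real t ^ 2"
      unfolding m_def by (intro mult_right_mono) auto
    also have "\<dots> \<le> e" unfolding e_def using t by (intro Max_ge) auto
    finally show "2 * real t * real (card {x\<in>X. diff_reps A' A' x \<ge> t}) \<le> 2 * e * inverse (real t)"
      using \<open>t > 0\<close> by (simp add: field_simps power2_eq_square)
  qed
  also have "\<dots> = 2 * e * h" unfolding h_def harmonic_def by (simp add: sum_distrib_left)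
  finally have E: "real (\<Sum>z\<in>X. diff_reps A' A' z ^ 2) \<le> 2 * e * h" .
  have "n ^ 4 \<le> (2 * real (card A')) ^ 4"
    unfolding n_def using half by (intro power_mono) auto
  also have "\<dots> = 16 * real (card A' ^ 4)" by (simp add: power_mult_distrib)
  also have "\<dots> \<le> 16 * real (card (A + A) * (\<Sum>z\<in>X. diff_reps A' A' z ^ 2))"
    unfolding X_def by (intro mult_left_mono of_nat_mono card_power4_le_energy[OF finA' sub fin]) auto
  also have "\<dots> = 16 * (s * real (\<Sum>z\<in>X. diff_reps A' A' z ^ 2))" by (simp add: s_def)
  also have "\<dots> \<le> 16 * (s * (2 * e * h))"
    using E hs by (intro mult_left_mono) auto
  finally have "n ^ 4 \<le> 32 * s * e * h" by simp
  then have "(n ^ 4) ^ 9 \<le> (32 * s * e * h) ^ 9" by (intro power_mono) (auto simp: n_def)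
  then have "n ^ 36 * n ^ 5 \<le> (32 * s * e * h) ^ 9 * n ^ 5"
    by (intro mult_right_mono) (auto simp: n_def simp flip: power_mult)
  also have "\<dots> = (32 * s * h) ^ 9 * (e ^ 9 * n ^ 5)" by (simp add: power_mult_distrib)
  also have "\<dots> \<le> (32 * s * h) ^ 9 * (27 * 162 ^ 6 * s ^ 10 * K ^ 11 * h ^ 9)"
    using e hs by (intro mult_left_mono) auto
  also have "\<dots> = 32 ^ 9 * 27 * 162 ^ 6 * s ^ 19 * K ^ 11 * h ^ 18"
    by algebra
  finally show ?thesis by (simp add: n_def s_def h_def flip: power_add)
qed

text \<open>Substituting \<open>K = 512 |P|^4 / T^3\<close> turns the factor \<open>K^11\<close>
  into \<open>512^11 |P|^44 / T^33\<close>.\<close>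

lemma sumset_ratio_bound:
  fixes A P :: "real set" and T :: real
  assumes fin: "finite A" "finite P" and ne: "A \<noteq> {}" and P: "0 \<notin> P" "card A \<le> card P" and T: "T \<ge> 1"
    and reps: "\<And>a. a \<in> A \<Longrightarrow> real (ratio_reps P P a) \<ge> T"
  shows "real (card A) ^ 41 * T ^ 33
    \<le> 32 ^ 9 * 27 * 162 ^ 6 * 512 ^ 11 * (1 + ln (card A)) ^ 18 * (real (card (A + A)) ^ 19 * real (card P) ^ 44)"
proof -
  let ?K = "512 * real (card P) ^ 4 / T ^ 3"
  let ?c = "32 ^ 9 * 27 * 162 ^ 6 :: real"
  have "popular_bound A ?K"
    unfolding popular_bound_def
  proof (intro allI impI)
    fix B :: "real set" and t :: nat
    assume "finite B" "t > 0"
    then show "real (card {x. diff_reps A B x \<ge> t}) * t ^ 3 \<le> ?K * (card B)\<^sup>2"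
      using card_popular_differences_le[OF fin(1) _ fin(2) P reps T, of B t] by simp
  qed
  then have "real (card A) ^ 41 \<le> ?c * real (card (A + A)) ^ 19 * ?K ^ 11 * harmonic (card A) ^ 18"
    by (rule sumset_bound_of_popular_bound[OF fin(1) ne])
  also have "\<dots> \<le> ?c * real (card (A + A)) ^ 19 * ?K ^ 11 * (1 + ln (card A)) ^ 18"
    using harmonic_le_one_add_ln[of "card A"] ne fin T
    by (intro mult_left_mono power_mono) (auto simp: card_gt_0_iff harmonic_nonneg)
  finally have "real (card A) ^ 41 * T ^ 33
      \<le> (?c * real (card (A + A)) ^ 19 * ?K ^ 11 * (1 + ln (card A)) ^ 18) * T ^ 33"
    using T by (intro mult_right_mono) auto
  also have "\<dots> = ?c * (1 + ln (card A)) ^ 18 * real (card (A + A)) ^ 19 * (?K ^ 11 * T ^ 33)"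
    by (simp only: mult_ac)
  also have "?K ^ 11 * T ^ 33 = 512 ^ 11 * real (card P) ^ 44"
    using T by (simp add: power_divide power_mult_distrib flip: power_mult)
  finally show ?thesis by (simp only: mult_ac)
qed

section \<open>Absorbing constants and logarithms into the exponent\<close>

theorem theorem1p5:
  shows "\<exists>\<epsilon> :: nat \<Rightarrow> real. \<epsilon> \<longlonglongrightarrow> 0 \<and>
    (\<forall>(A :: real set) (\<Pi> :: real set) (T :: real).
      finite A \<longrightarrow> finite \<Pi> \<longrightarrow> A \<subseteq> UNIV - {0} \<longrightarrow> \<Pi> \<subseteq> UNIV - {0} \<longrightarrow>
      card \<Pi> \<ge> card A \<longrightarrow> T \<ge> 1 \<longrightarrow>
      (\<forall>a\<in>A. real (ratio_reps \<Pi> \<Pi> a) \<ge> T) \<longrightarrow>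
      real (card (A + A)) ^ 19 * real (card \<Pi>) ^ 44
        \<ge> real (card A) powr (41 - \<epsilon> (card A)) * T ^ 33)"
proof -
  define C :: real where "C = 32 ^ 9 * 27 * 162 ^ 6 * 512 ^ 11"
  \<comment> \<open>Chosen so that \<open>n powr \<epsilon> n\<close> equals the lost factor
    \<open>C (1 + ln n)^18\<close> for \<open>n \<ge> 2\<close>. It depends on \<open>n\<close>
    alone, which gives the uniformity.\<close>
  define \<epsilon> where "\<epsilon> n = ln (C * (1 + ln (real n)) ^ 18) / ln (real n)" for n
  have C: "C > 0" by (simp add: C_def)
  have lim: "\<epsilon> \<longlonglongrightarrow> 0" unfolding \<epsilon>_def using C by real_asymp
  have "real (card A) powr (41 - \<epsilon> (card A)) * T ^ 33 \<le> real (card (A + A)) ^ 19 * real (card P) ^ 44"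
    if H: "finite A" "finite P" "P \<subseteq> UNIV - {0}" "card P \<ge> card A" "T \<ge> 1"
      "\<forall>a\<in>A. real (ratio_reps P P a) \<ge> T" for A P :: "real set" and T :: real
  proof -
    \<comment> \<open>For \<open>card A \<le> 1\<close> the left power is 0 or 1 whatever the
      exponent, so no loss can be absorbed there; for a singleton \<open>T \<le> card P\<close>
      suffices.\<close>
    consider "card A = 0" | "card A = 1" | "card A \<ge> 2" by linarith
    then show ?thesis
    proof cases
      case 1
      then show ?thesis by simp
    next
      case 2
      then obtain a where A: "A = {a}" by (auto simp: card_1_singleton_iff)
      have "T \<le> ratio_reps P P a" using H A by simp
      also have "\<dots> \<le> card P" using ratio_reps_le_card[of P P a] H by auto
      finally have TP: "T \<le> card P" .
      have "T ^ 33 \<le> real (card P) ^ 33" using TP H by (intro power_mono) auto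
      also have "\<dots> \<le> real (card P) ^ 44" using H 2 by (intro power_increasing) auto
      finally have "T ^ 33 \<le> real (card P) ^ 44" .
      moreover have "{a} + {a} = {a + a}" by (auto simp: set_plus_def)
      ultimately show ?thesis using A by simp
    next
      case 3
      define n where "n = real (card A)"
      define g where "g = C * (1 + ln n) ^ 18"
      have n: "n \<ge> 2" using 3 by (simp add: n_def)
      have "1 + ln n > 0" using n by (simp add: add_pos_nonneg)
      then have g: "g > 0" using C by (simp add: g_def)
      have "n powr \<epsilon> (card A) = g"
        using n g by (simp add: powr_def \<epsilon>_def g_def n_def)
      then have "n powr (41 - \<epsilon> (card A)) = n ^ 41 / g"
        using n by (simp add: powr_diff powr_numeral)
      moreover have "n ^ 41 * T ^ 33 \<le> g * (real (card (A + A)) ^ 19 * real (card P) ^ 44)"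
      proof -
        have "A \<noteq> {}" "0 \<notin> P" using H 3 by auto
        then show ?thesis
          using sumset_ratio_bound[of A P T] H by (simp add: n_def g_def C_def)
      qed
      ultimately show ?thesis
        using g unfolding n_def[symmetric] by (simp add: pos_divide_le_eq mult_ac)
    qed
  qed
  then show ?thesis using lim by blast
qed

end
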